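(* The problem of $L_2$-approximation on the classes $F_d^{\log}$ with linear algorithms suffers from the curse of dimensionality. For any $d\in\mathbb{N}$ and any linear mapping $A_n\colon F_d^{\log}\to L_2([0,1]^d)$ with rank $n\le 5^d/2$, we have \[ \sup_{f\in F_d^{\log}}\|f-A_n(f)\|_2\,\ge\,\frac{1}{\sqrt 2}. \]
   Context: For $f\in C([0,1]^d)$ (continuous, complex-valued) and $k\in\mathbb{Z}^d$, let $\hat f(k)=\int_{[0,1]^d} f(x)e^{-2\pi i\langle k,x\rangle}\,dx$. Define the function class \[ F_d^{\log}:=\Big\{f\in C([0,1]^d)\ \Big|\ \sum_{k\in\mathbb{Z}^d}|\hat f(k)|\max(1,\log\|k\|_\infty)\le 1\Big\}, \] where the factor $\max(1,\log\|k\|_\infty)$ equals $1$ for $k=0$. A linear mapping on $F_d^{\log}$ means the restriction to $F_d^{\log}$ of a linear map defined on the linear span of $F_d^{\log}$; its rank is the rank of that linear map. A linear (sampling) algorithm is a map of the form $A_n(f)=\phi(f(x_1),\dots,f(x_n))$ with points $x_j\in[0,1]^d$ and a linear map $\phi\colon\mathbb{C}^n\to L_2([0,1]^d)$. The problem of $L_2$-approximation on $F_d^{\log}$ with linear algorithms suffers from the curse of dimensionality if there exist $C,\gamma,\varepsilon>0$ such that, for all $d\in\mathbb{N}$, the minimal $n$ for which some linear algorithm $A_n$ satisfies $\sup_{f\in F_d^{\log}}\|f-A_n(f)\|_2\le\varepsilon$ is bounded below by $C(1+\gamma)^d$. *)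

theory Defs
  imports "HOL-Analysis.Analysis" "HOL-Library.Function_Algebras"
begin

text \<open>
  The dimension has to be quantified over inside the statement, so points of the cube
  are functions on the naturals that are extensional on the index set \<open>{..<d}\<close>, and likewise
  for integer vectors. Continuity on the cube refers to the product topology on functions,
  which on this set is the usual topology of the unit cube.
\<close>

definition cube :: "nat \<Rightarrow> (nat \<Rightarrow> real) set" where
  "cube d = {..<d} \<rightarrow>\<^sub>E {0..1}"

definition cube_measure :: "nat \<Rightarrow> (nat \<Rightarrow> real) measure" where
  "cube_measure d = (\<Pi>\<^sub>M i\<in>{..<d}. restrict_space lborel {0..1})"

lemma space_cube_measure: "space (cube_measure d) = cube d"
  by (simp add: cube_measure_def cube_def space_PiM space_restrict_space)

definition int_vectors :: "nat \<Rightarrow> (nat \<Rightarrow> int) set" where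
  "int_vectors d = {..<d} \<rightarrow>\<^sub>E UNIV"

definition max_norm :: "nat \<Rightarrow> (nat \<Rightarrow> int) \<Rightarrow> int" where
  "max_norm d k = Max ((\<lambda>i. \<bar>k i\<bar>) ` {..<d})"

definition fourier_coeff :: "nat \<Rightarrow> ((nat \<Rightarrow> real) \<Rightarrow> complex) \<Rightarrow> (nat \<Rightarrow> int) \<Rightarrow> complex" where
  "fourier_coeff d f k =
     (LINT x|cube_measure d.
        f x * exp (- 2 * of_real pi * \<i> * of_real (\<Sum>i<d. of_int (k i) * x i)))"

text \<open>Setting functions to 0 off the cube makes each continuous function on the cube correspond
  to exactly one function on the whole type, and keeps the set closed under pointwise operations.\<close>

definition C_cube :: "nat \<Rightarrow> ((nat \<Rightarrow> real) \<Rightarrow> complex) set" where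
  "C_cube d = {f. continuous_on (cube d) f \<and> (\<forall>x. x \<notin> cube d \<longrightarrow> f x = 0)}"

text \<open>As \<open>ln 0 = 0\<close> in HOL, the weight at \<open>k = 0\<close> is 1, as required.\<close>

definition F_log :: "nat \<Rightarrow> ((nat \<Rightarrow> real) \<Rightarrow> complex) set" where
  "F_log d = {f \<in> C_cube d.
     (\<lambda>k. norm (fourier_coeff d f k) * max 1 (ln (real_of_int (max_norm d k))))
       summable_on int_vectors d \<and>
     (\<Sum>\<^sub>\<infinity>k\<in>int_vectors d.
        norm (fourier_coeff d f k) * max 1 (ln (real_of_int (max_norm d k)))) \<le> 1}"

definition fun_scale :: "complex \<Rightarrow> ('a \<Rightarrow> complex) \<Rightarrow> 'a \<Rightarrow> complex" where
  "fun_scale c f = (\<lambda>x. c * f x)"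

lemma vector_space_fun_scale: "vector_space (fun_scale :: complex \<Rightarrow> ('a \<Rightarrow> complex) \<Rightarrow> _)"
  by unfold_locales (auto simp: fun_scale_def fun_eq_iff algebra_simps)

definition complex_span :: "('a \<Rightarrow> complex) set \<Rightarrow> ('a \<Rightarrow> complex) set" where
  "complex_span = module.span fun_scale"

text \<open>Elements of \<open>L\<^sub>2\<close> are represented by square-integrable functions; identities
  between them (linearity of maps into \<open>L\<^sub>2\<close>, linear dependence) are required almost
  everywhere only.\<close>

definition L2_cube :: "nat \<Rightarrow> ((nat \<Rightarrow> real) \<Rightarrow> complex) set" where
  "L2_cube d = {g \<in> borel_measurable (cube_measure d).
     integrable (cube_measure d) (\<lambda>x. (norm (g x))\<^sup>2)}"

definition L2_norm :: "nat \<Rightarrow> ((nat \<Rightarrow> real) \<Rightarrow> complex) \<Rightarrow> real" where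
  "L2_norm d g = sqrt (LINT x|cube_measure d. (norm (g x))\<^sup>2)"

definition linear_into_L2 ::
    "nat \<Rightarrow> ('a \<Rightarrow> complex) set \<Rightarrow> (('a \<Rightarrow> complex) \<Rightarrow> (nat \<Rightarrow> real) \<Rightarrow> complex) \<Rightarrow> bool" where
  "linear_into_L2 d V T \<longleftrightarrow>
     (\<forall>f\<in>V. T f \<in> L2_cube d) \<and>
     (\<forall>f\<in>V. \<forall>g\<in>V. AE x in cube_measure d. T (f + g) x = T f x + T g x) \<and>
     (\<forall>c. \<forall>f\<in>V. AE x in cube_measure d. T (fun_scale c f) x = c * T f x)"

text \<open>The set of classes modulo almost everywhere equality of the functions in \<open>W\<close> has a basis
  with \<open>n\<close> elements.\<close>

definition has_L2_dim :: "nat \<Rightarrow> ((nat \<Rightarrow> real) \<Rightarrow> complex) set \<Rightarrow> nat \<Rightarrow> bool" where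
  "has_L2_dim d W n \<longleftrightarrow>
     (\<exists>b. (\<forall>j<n. b j \<in> W) \<and>
          (\<forall>c. (AE x in cube_measure d. (\<Sum>j<n. c j * b j x) = 0) \<longrightarrow> (\<forall>j<n. c j = 0)) \<and>
          (\<forall>g\<in>W. \<exists>c. AE x in cube_measure d. g x = (\<Sum>j<n. c j * b j x)))"

definition has_rank ::
    "nat \<Rightarrow> ('a \<Rightarrow> complex) set \<Rightarrow> (('a \<Rightarrow> complex) \<Rightarrow> (nat \<Rightarrow> real) \<Rightarrow> complex) \<Rightarrow> nat \<Rightarrow> bool" where
  "has_rank d V T n \<longleftrightarrow> has_L2_dim d (T ` V) n"

text \<open>The supremum is taken in the extended reals, since a linear map need not be bounded.\<close>

definition worst_case_error ::
    "nat \<Rightarrow> ((nat \<Rightarrow> real) \<Rightarrow> complex) set \<Rightarrow>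
     (((nat \<Rightarrow> real) \<Rightarrow> complex) \<Rightarrow> (nat \<Rightarrow> real) \<Rightarrow> complex) \<Rightarrow> ereal" where
  "worst_case_error d F A = (SUP f\<in>F. ereal (L2_norm d (\<lambda>x. f x - A f x)))"

definition complex_vectors :: "nat \<Rightarrow> (nat \<Rightarrow> complex) set" where
  "complex_vectors n = {v. \<forall>j\<ge>n. v j = 0}"

definition sampling_algorithm ::
    "nat \<Rightarrow> nat \<Rightarrow> (((nat \<Rightarrow> real) \<Rightarrow> complex) \<Rightarrow> (nat \<Rightarrow> real) \<Rightarrow> complex) \<Rightarrow> bool" where
  "sampling_algorithm d n A \<longleftrightarrow>
     (\<exists>p \<phi>. (\<forall>j<n. p j \<in> cube d) \<and> linear_into_L2 d (complex_vectors n) \<phi> \<and>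
            A = (\<lambda>f. \<phi> (\<lambda>j. if j < n then f (p j) else 0)))"

text \<open>The minimal number of samples, equal to \<open>\<infinity>\<close> if no number of samples suffices.\<close>

definition sample_complexity ::
    "nat \<Rightarrow> ((nat \<Rightarrow> real) \<Rightarrow> complex) set \<Rightarrow> real \<Rightarrow> ereal" where
  "sample_complexity d F \<epsilon> =
     (INF n\<in>{n. \<exists>A. sampling_algorithm d n A \<and> worst_case_error d F A \<le> ereal \<epsilon>}.
        ereal (real n))"

definition curse_of_dimensionality :: "(nat \<Rightarrow> ((nat \<Rightarrow> real) \<Rightarrow> complex) set) \<Rightarrow> bool" where
  "curse_of_dimensionality F \<longleftrightarrow>
     (\<exists>C>0. \<exists>\<gamma>>0. \<exists>\<epsilon>>0. \<forall>d\<ge>1. ereal (C * (1 + \<gamma>) ^ d) \<le> sample_complexity d (F d) \<epsilon>)"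

end

theory Submission
  imports Defs "HOL-Probability.Infinite_Product_Measure"
begin

text \<open>
  The class contains a large orthonormal system: for an integer vector \<open>k\<close> with all entries
  in \<open>{-2..2}\<close> the exponential \<open>e\<^sub>k(x) = exp (2 \<pi> \<i> \<langle>k, x\<rangle>)\<close> has a single nonzero Fourier
  coefficient, equal to 1, and its weight is 1 because \<open>ln 2 < 1\<close>. So all these
  \<open>N = 5\<^sup>d\<close> functions lie in the class (\<open>character_in_F_log\<close>). The bound 2 is the largest
  integer below \<open>exp 1\<close>, which is where the 5 comes from.

  An orthonormal system cannot be approximated well by a space \<open>W\<close> of dimension \<open>n\<close> much
  smaller than \<open>N\<close>. Let \<open>u\<^sub>1, \<dots>, u\<^sub>m\<close> with \<open>m \<le> n\<close> be an orthonormal basis of \<open>W\<close>. The squared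
  distance of \<open>e\<^sub>k\<close> to \<open>W\<close> is \<open>1 - (\<Sum>j. \<bar>\<langle>e\<^sub>k, u\<^sub>j\<rangle>\<bar>\<^sup>2)\<close>. Summed over \<open>k\<close>, the subtracted
  double sum is at most \<open>m\<close>, since by Bessel's inequality for the system \<open>e\<close> each \<open>u\<^sub>j\<close>
  contributes at most its squared norm 1. Hence the squared errors add up to at least
  \<open>N - n\<close> (\<open>sum_squared_errors_ge\<close>), and if \<open>n \<le> N / 2\<close> then one of them is at least \<open>1 / 2\<close>.

  This uses only that the values of the algorithm lie in the span of \<open>n\<close> functions
  (\<open>worst_case_error_ge_if_spanned\<close>). It therefore applies both to a linear map of rank
  \<open>n\<close> and to a sampling algorithm with \<open>n\<close> points, whose values are spanned by
  the images of the unit vectors. In the second case an error of at most \<open>1 / 2 < 1 / sqrt 2\<close>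
  forces \<open>n > 5\<^sup>d / 2\<close>, which is the curse of dimensionality.
\<close>

section \<open>Square-integrable functions on a measure space\<close>

definition square_integrable :: "'a measure \<Rightarrow> ('a \<Rightarrow> complex) \<Rightarrow> bool" where
  "square_integrable M f \<longleftrightarrow> f \<in> borel_measurable M \<and> integrable M (\<lambda>x. (norm (f x))\<^sup>2)"

definition L2_inner :: "'a measure \<Rightarrow> ('a \<Rightarrow> complex) \<Rightarrow> ('a \<Rightarrow> complex) \<Rightarrow> complex" where
  "L2_inner M f g = (LINT x|M. f x * cnj (g x))"

lemma square_integrable_measurable:
  "square_integrable M f \<Longrightarrow> f \<in> borel_measurable M"
  by (simp add: square_integrable_def)

lemma integrable_mult_cnj:
  assumes f: "square_integrable M f" and g: "square_integrable M g"
  shows "integrable M (\<lambda>x. f x * cnj (g x))"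
proof (rule Bochner_Integration.integrable_bound)
  note [measurable] = square_integrable_measurable[OF f] square_integrable_measurable[OF g]
  show "integrable M (\<lambda>x. (norm (f x))\<^sup>2 + (norm (g x))\<^sup>2)"
    using f g by (auto simp: square_integrable_def)
  show "(\<lambda>x. f x * cnj (g x)) \<in> borel_measurable M"
    by (intro borel_measurable_times borel_measurable_continuous_on[OF _ square_integrable_measurable[OF g]]
          continuous_intros square_integrable_measurable[OF f])
  have "a * b \<le> a\<^sup>2 + b\<^sup>2" if "a \<ge> 0" "b \<ge> 0" for a b :: real
    using sum_squares_bound[of a b] mult_nonneg_nonneg[OF that] by linarith
  then show "AE x in M. norm (f x * cnj (g x)) \<le> norm ((norm (f x))\<^sup>2 + (norm (g x))\<^sup>2)"
    by (simp add: norm_mult)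
qed

lemma square_integrable_scale:
  assumes f: "square_integrable M f"
  shows "square_integrable M (\<lambda>x. c * f x)"
  using f by (auto simp: square_integrable_def norm_mult power_mult_distrib)

lemma square_integrable_add:
  assumes f: "square_integrable M f" and g: "square_integrable M g"
  shows "square_integrable M (\<lambda>x. f x + g x)"
  unfolding square_integrable_def
proof
  note [measurable] = square_integrable_measurable[OF f] square_integrable_measurable[OF g]
  show "(\<lambda>x. f x + g x) \<in> borel_measurable M" by measurable
  show "integrable M (\<lambda>x. (norm (f x + g x))\<^sup>2)"
  proof (rule Bochner_Integration.integrable_bound)
    show "integrable M (\<lambda>x. 2 * (norm (f x))\<^sup>2 + 2 * (norm (g x))\<^sup>2)"
      using f g by (auto simp: square_integrable_def)
    show "(\<lambda>x. (norm (f x + g x))\<^sup>2) \<in> borel_measurable M" by measurable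
    have "(norm (a + b))\<^sup>2 \<le> 2 * (norm a)\<^sup>2 + 2 * (norm b)\<^sup>2" for a b :: complex
    proof -
      have "(norm (a + b))\<^sup>2 \<le> (norm a + norm b)\<^sup>2"
        by (intro power_mono norm_triangle_ineq) simp
      also have "\<dots> \<le> 2 * (norm a)\<^sup>2 + 2 * (norm b)\<^sup>2"
        using sum_squares_bound[of "norm a" "norm b"] by (simp add: power2_sum)
      finally show ?thesis .
    qed
    then show "AE x in M. norm ((norm (f x + g x))\<^sup>2) \<le> norm (2 * (norm (f x))\<^sup>2 + 2 * (norm (g x))\<^sup>2)"
      by simp
  qed
qed

lemma square_integrable_diff:
  assumes "square_integrable M f" "square_integrable M g"
  shows "square_integrable M (\<lambda>x. f x - g x)"
  using square_integrable_add[OF assms(1) square_integrable_scale[OF assms(2), of "-1"]] by simp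

lemma square_integrable_sum:
  assumes "\<And>j. j \<in> J \<Longrightarrow> square_integrable M (u j)"
  shows "square_integrable M (\<lambda>x. \<Sum>j\<in>J. c j * u j x)"
  using assms
proof (induction J rule: infinite_finite_induct)
  case (insert j J)
  then show ?case
    by (auto intro!: square_integrable_add square_integrable_scale)
qed (auto simp: square_integrable_def)

lemma L2_inner_cnj: "cnj (L2_inner M f g) = L2_inner M g f"
  by (simp add: L2_inner_def mult.commute flip: Bochner_Integration.integral_cnj)

lemma L2_inner_self: "L2_inner M f f = of_real (LINT x|M. (norm (f x))\<^sup>2)"
  by (simp add: L2_inner_def complex_norm_square[symmetric] flip: integral_complex_of_real)

lemma L2_inner_scale_left: "L2_inner M (\<lambda>x. c * f x) g = c * L2_inner M f g"
  by (simp add: L2_inner_def mult.assoc)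

lemma L2_inner_diff_left:
  assumes "square_integrable M f" "square_integrable M g" "square_integrable M h"
  shows "L2_inner M (\<lambda>x. f x - g x) h = L2_inner M f h - L2_inner M g h"
  using assms by (simp add: L2_inner_def left_diff_distrib integrable_mult_cnj)

lemma L2_inner_sum_left:
  assumes "\<And>j. j \<in> J \<Longrightarrow> square_integrable M (u j)" "square_integrable M h"
  shows "L2_inner M (\<lambda>x. \<Sum>j\<in>J. c j * u j x) h = (\<Sum>j\<in>J. c j * L2_inner M (u j) h)"
  using assms
  by (simp add: L2_inner_def sum_distrib_right mult.assoc integrable_mult_cnj)

lemma L2_inner_diff_right:
  assumes "square_integrable M f" "square_integrable M g" "square_integrable M h"
  shows "L2_inner M h (\<lambda>x. f x - g x) = L2_inner M h f - L2_inner M h g"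
  using arg_cong[where f = cnj, OF L2_inner_diff_left[OF assms]] by (simp add: L2_inner_cnj)

lemma L2_inner_sum_right:
  assumes "\<And>j. j \<in> J \<Longrightarrow> square_integrable M (u j)" "square_integrable M h"
  shows "L2_inner M h (\<lambda>x. \<Sum>j\<in>J. c j * u j x) = (\<Sum>j\<in>J. cnj (c j) * L2_inner M h (u j))"
  using arg_cong[where f = cnj, OF L2_inner_sum_left[OF assms]] by (simp add: L2_inner_cnj)

section \<open>Orthonormal families and approximation from finite-dimensional spaces\<close>

definition orthonormal_family :: "'a measure \<Rightarrow> 'i set \<Rightarrow> ('i \<Rightarrow> 'a \<Rightarrow> complex) \<Rightarrow> bool" where
  "orthonormal_family M J u \<longleftrightarrow> (\<forall>j\<in>J. square_integrable M (u j)) \<and>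
     (\<forall>i\<in>J. \<forall>j\<in>J. L2_inner M (u i) (u j) = (if i = j then 1 else 0))"

text \<open>
  The distance of \<open>f\<close> to an arbitrary combination splits into the distance to the span and a
  sum of squares that vanishes exactly when the \<open>c j\<close> are the coefficients of the orthogonal
  projection. The identity is used in two directions: dropping the last sum bounds the
  approximation error from below, and choosing the projection gives Bessel's inequality.
\<close>

lemma distance_to_orthonormal_combination:
  assumes J: "finite J" and u: "orthonormal_family M J u" and f: "square_integrable M f"
  shows "(LINT x|M. (norm (f x - (\<Sum>j\<in>J. c j * u j x)))\<^sup>2) =
    (LINT x|M. (norm (f x))\<^sup>2) - (\<Sum>j\<in>J. (norm (L2_inner M f (u j)))\<^sup>2)
      + (\<Sum>j\<in>J. (norm (c j - L2_inner M f (u j)))\<^sup>2)"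
proof -
  define s where "s = (\<lambda>x. \<Sum>j\<in>J. c j * u j x)"
  define a where "a j = L2_inner M f (u j)" for j
  have uj: "square_integrable M (u j)" if "j \<in> J" for j
    using u that by (simp add: orthonormal_family_def)
  have s: "square_integrable M s"
    unfolding s_def by (rule square_integrable_sum[OF uj])
  have fs: "L2_inner M f s = (\<Sum>j\<in>J. cnj (c j) * a j)"
    unfolding s_def a_def by (rule L2_inner_sum_right[OF uj f])
  have sf: "L2_inner M s f = (\<Sum>j\<in>J. c j * cnj (a j))"
    using arg_cong[where f = cnj, OF fs] by (simp add: L2_inner_cnj)
  have us: "L2_inner M (u j) s = cnj (c j)" if "j \<in> J" for j
  proof -
    have "L2_inner M (u j) s = (\<Sum>i\<in>J. cnj (c i) * L2_inner M (u j) (u i))"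
      unfolding s_def by (rule L2_inner_sum_right[OF uj uj[OF that]])
    also have "\<dots> = (\<Sum>i\<in>J. if j = i then cnj (c i) else 0)"
      using u that by (intro sum.cong) (auto simp: orthonormal_family_def)
    finally show ?thesis using J that by simp
  qed
  have ss: "L2_inner M s s = (\<Sum>j\<in>J. c j * cnj (c j))"
    using L2_inner_sum_left[of J M u s c, OF uj s] us by (simp add: s_def)
  have "of_real (LINT x|M. (norm (f x - s x))\<^sup>2)
      = L2_inner M (\<lambda>x. f x - s x) (\<lambda>x. f x - s x)"
    by (simp add: L2_inner_self)
  also have "\<dots> = L2_inner M f f - L2_inner M f s - L2_inner M s f + L2_inner M s s"
    using f s by (simp add: L2_inner_diff_left L2_inner_diff_right square_integrable_diff)
  also have "\<dots> = L2_inner M f f - (\<Sum>j\<in>J. a j * cnj (a j))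
      + (\<Sum>j\<in>J. (c j - a j) * cnj (c j - a j))"
    by (simp add: fs sf ss algebra_simps sum.distrib sum_subtractf)
  also have "\<dots> = of_real ((LINT x|M. (norm (f x))\<^sup>2) - (\<Sum>j\<in>J. (norm (a j))\<^sup>2)
      + (\<Sum>j\<in>J. (norm (c j - a j))\<^sup>2))"
    by (simp add: L2_inner_self complex_norm_square del: complex_cnj_diff of_real_power)
  finally show ?thesis
    unfolding of_real_eq_iff by (simp add: s_def a_def)
qed

lemma Bessel_inequality:
  assumes "finite J" "orthonormal_family M J u" "square_integrable M f"
  shows "(\<Sum>j\<in>J. (norm (L2_inner M f (u j)))\<^sup>2) \<le> (LINT x|M. (norm (f x))\<^sup>2)"
proof -
  have "0 \<le> (LINT x|M. (norm (f x - (\<Sum>j\<in>J. L2_inner M f (u j) * u j x)))\<^sup>2)"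
    by simp
  then show ?thesis
    using distance_to_orthonormal_combination[OF assms, of "\<lambda>j. L2_inner M f (u j)"] by simp
qed

lemma orthonormal_norm:
  assumes "orthonormal_family M J u" "j \<in> J"
  shows "(LINT x|M. (norm (u j x))\<^sup>2) = 1"
proof -
  have "of_real (LINT x|M. (norm (u j x))\<^sup>2) = (1 :: complex)"
    using assms unfolding L2_inner_self[symmetric] by (simp add: orthonormal_family_def)
  then show ?thesis by (simp only: of_real_eq_1_iff)
qed

text \<open>
  Gram--Schmidt for possibly dependent families: a function whose residual after projection
  vanishes almost everywhere contributes no new vector, so \<open>m\<close> may be smaller than \<open>n\<close>.
  The conclusion asks for a span that contains the \<open>b\<close>, because enlarging the approximating
  space only lowers the errors that are to be bounded from below.
\<close>

lemma Gram_Schmidt_AE: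
  fixes b :: "nat \<Rightarrow> 'a \<Rightarrow> complex"
  assumes "\<And>j. j < n \<Longrightarrow> square_integrable M (b j)"
  shows "\<exists>m\<le>n. \<exists>u. orthonormal_family M {..<m} u \<and>
    (\<forall>c. \<exists>c'. AE x in M. (\<Sum>j<n. c j * b j x) = (\<Sum>j<m. c' j * u j x))"
  using assms
proof (induction n)
  case 0
  show ?case by (auto simp: orthonormal_family_def)
next
  case (Suc n)
  have "\<And>j. j < n \<Longrightarrow> square_integrable M (b j)" using Suc.prems by simp
  from Suc.IH[OF this] obtain m u where m: "m \<le> n" and u: "orthonormal_family M {..<m} u"
    and span: "\<And>c. \<exists>c'. AE x in M. (\<Sum>j<n. c j * b j x) = (\<Sum>j<m. c' j * u j x)"
    by blast
  have b: "square_integrable M (b n)" using Suc.prems by simp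
  have uj: "square_integrable M (u j)" if "j < m" for j
    using u that by (simp add: orthonormal_family_def)
  define a where "a j = L2_inner M (b n) (u j)" for j
  define r where "r = (\<lambda>x. b n x - (\<Sum>j<m. a j * u j x))"
  define t where "t = (LINT x|M. (norm (r x))\<^sup>2)"
  have r: "square_integrable M r"
    unfolding r_def by (intro square_integrable_diff square_integrable_sum b) (simp add: uj)
  have r_orth: "L2_inner M r (u i) = 0" if "i < m" for i
  proof -
    have "L2_inner M r (u i) = L2_inner M (b n) (u i) - (\<Sum>j<m. a j * L2_inner M (u j) (u i))"
      unfolding r_def
      using that uj by (subst L2_inner_diff_left L2_inner_sum_left; (intro b square_integrable_sum)?; simp)+
    also have "(\<Sum>j<m. a j * L2_inner M (u j) (u i)) = (\<Sum>j<m. if i = j then a j else 0)"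
      using u that by (intro sum.cong) (auto simp: orthonormal_family_def)
    finally show ?thesis using that by (simp add: a_def)
  qed
  show ?case
  proof (cases "t = 0")
    case True
    have "AE x in M. (norm (r x))\<^sup>2 = 0"
      using True r unfolding t_def
      by (subst (asm) integral_nonneg_eq_0_iff_AE) (auto simp: square_integrable_def)
    then have r0: "AE x in M. r x = 0" by simp
    have "\<exists>c'. AE x in M. (\<Sum>j<Suc n. c j * b j x) = (\<Sum>j<m. c' j * u j x)" for c
    proof -
      obtain c' where c': "AE x in M. (\<Sum>j<n. c j * b j x) = (\<Sum>j<m. c' j * u j x)"
        using span by blast
      have "AE x in M. (\<Sum>j<Suc n. c j * b j x) = (\<Sum>j<m. (c' j + c n * a j) * u j x)"
        using c' r0
      proof eventually_elim
        case (elim x)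
        have "b n x = (\<Sum>j<m. a j * u j x)" using elim(2) by (simp add: r_def)
        then show ?case
          using elim(1) by (simp add: algebra_simps sum.distrib sum_distrib_left)
      qed
      then show ?thesis by (rule exI[where x = "\<lambda>j. c' j + c n * a j"])
    qed
    then show ?thesis using m u le_SucI by blast
  next
    case False
    have "t \<ge> 0" unfolding t_def by simp
    with False have t: "t > 0" by simp
    define v where "v = (\<lambda>x. of_real (1 / sqrt t) * r x)"
    define w where "w = (\<lambda>j. if j < m then u j else v)"
    have v: "square_integrable M v"
      unfolding v_def by (rule square_integrable_scale[OF r])
    have v_orth: "L2_inner M v (u i) = 0" if "i < m" for i
      unfolding v_def L2_inner_scale_left using r_orth[OF that] by simp
    have v_orth': "L2_inner M (u i) v = 0" if "i < m" for i
      using v_orth[OF that] L2_inner_cnj[of M v "u i"] by simp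
    have "(LINT x|M. (norm (v x))\<^sup>2) = (1 / sqrt t)\<^sup>2 * t"
      unfolding v_def norm_mult power_mult_distrib t_def by (simp add: norm_divide)
    also have "\<dots> = 1" using t by (simp add: power_divide)
    finally have "L2_inner M v v = 1" by (simp add: L2_inner_self)
    then have w: "orthonormal_family M {..<Suc m} w"
      using u v v_orth v_orth' unfolding orthonormal_family_def w_def
      by (auto simp: less_Suc_eq)
    have "\<exists>c'. AE x in M. (\<Sum>j<Suc n. c j * b j x) = (\<Sum>j<Suc m. c' j * w j x)" for c
    proof -
      obtain c' where c': "AE x in M. (\<Sum>j<n. c j * b j x) = (\<Sum>j<m. c' j * u j x)"
        using span by blast
      define c'' where "c'' j = (if j < m then c' j + c n * a j else c n * of_real (sqrt t))" for j
      have "AE x in M. (\<Sum>j<Suc n. c j * b j x) = (\<Sum>j<Suc m. c'' j * w j x)"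
        using c'
      proof eventually_elim
        case (elim x)
        have "of_real (sqrt t) * v x = r x" using t by (simp add: v_def)
        then have "b n x = (\<Sum>j<m. a j * u j x) + of_real (sqrt t) * v x"
          by (simp add: r_def)
        then show ?case
          using elim by (simp add: c''_def w_def algebra_simps sum.distrib sum_distrib_left)
      qed
      then show ?thesis by (rule exI[where x = c''])
    qed
    then show ?thesis using m w by (meson Suc_le_mono)
  qed
qed

text \<open>
  The sum of \<open>\<bar>\<langle>e\<^sub>k, u\<^sub>j\<rangle>\<bar>\<^sup>2\<close> over \<open>k\<close> and \<open>j\<close> measures how much of the system \<open>e\<close> an orthonormal
  basis \<open>u\<close> of the approximating space can capture. Bessel's inequality is applied to \<open>u\<^sub>j\<close>
  with respect to the family \<open>e\<close>, not the other way round: it bounds the captured part by the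
  number of the \<open>u\<^sub>j\<close>.
\<close>

lemma sum_squared_errors_ge:
  fixes e g :: "'i \<Rightarrow> 'a \<Rightarrow> complex" and b :: "nat \<Rightarrow> 'a \<Rightarrow> complex"
  assumes K: "finite K" and e: "orthonormal_family M K e"
    and b: "\<And>j. j < n \<Longrightarrow> square_integrable M (b j)"
    and g_meas: "\<And>k. k \<in> K \<Longrightarrow> g k \<in> borel_measurable M"
    and g_span: "\<And>k. k \<in> K \<Longrightarrow> \<exists>c. AE x in M. g k x = (\<Sum>j<n. c j * b j x)"
  shows "real (card K) - real n \<le> (\<Sum>k\<in>K. LINT x|M. (norm (e k x - g k x))\<^sup>2)"
proof -
  obtain m u where m: "m \<le> n" and u: "orthonormal_family M {..<m} u"
    and span: "\<And>c. \<exists>c'. AE x in M. (\<Sum>j<n. c j * b j x) = (\<Sum>j<m. c' j * u j x)"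
    using Gram_Schmidt_AE[of n M b, OF b] by blast
  have ek: "square_integrable M (e k)" if "k \<in> K" for k
    using e that by (simp add: orthonormal_family_def)
  have uj: "square_integrable M (u j)" if "j < m" for j
    using u that by (simp add: orthonormal_family_def)
  have error: "1 - (\<Sum>j<m. (norm (L2_inner M (e k) (u j)))\<^sup>2)
      \<le> (LINT x|M. (norm (e k x - g k x))\<^sup>2)" if k: "k \<in> K" for k
  proof -
    obtain c where c: "AE x in M. g k x = (\<Sum>j<n. c j * b j x)" using g_span[OF k] by blast
    obtain c' where c': "AE x in M. (\<Sum>j<n. c j * b j x) = (\<Sum>j<m. c' j * u j x)"
      using span by blast
    have s: "square_integrable M (\<lambda>x. \<Sum>j<m. c' j * u j x)"
      by (rule square_integrable_sum) (simp add: uj)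
    note [measurable] = g_meas[OF k] square_integrable_measurable[OF ek[OF k]]
      square_integrable_measurable[OF s]
    have "(LINT x|M. (norm (e k x - g k x))\<^sup>2)
        = (LINT x|M. (norm (e k x - (\<Sum>j<m. c' j * u j x)))\<^sup>2)"
      using c c' by (intro integral_cong_AE) (measurable, auto)
    also have "\<dots> = 1 - (\<Sum>j<m. (norm (L2_inner M (e k) (u j)))\<^sup>2)
        + (\<Sum>j<m. (norm (c' j - L2_inner M (e k) (u j)))\<^sup>2)"
      by (simp add: distance_to_orthonormal_combination[OF _ u ek[OF k]] orthonormal_norm[OF e k])
    finally show ?thesis by (simp add: sum_nonneg)
  qed
  have "norm (L2_inner M f h) = norm (L2_inner M h f)" for f h
    using complex_mod_cnj[of "L2_inner M h f"] by (simp add: L2_inner_cnj)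
  then have "(\<Sum>k\<in>K. \<Sum>j<m. (norm (L2_inner M (e k) (u j)))\<^sup>2)
      = (\<Sum>j<m. \<Sum>k\<in>K. (norm (L2_inner M (u j) (e k)))\<^sup>2)"
    by (subst sum.swap) simp
  also have "\<dots> \<le> (\<Sum>j<m. 1)"
    using Bessel_inequality[OF K e uj] orthonormal_norm[OF u] by (intro sum_mono) simp
  also have "\<dots> \<le> real n" using m by simp
  finally have "real (card K) - real n
      \<le> (\<Sum>k\<in>K. 1 - (\<Sum>j<m. (norm (L2_inner M (e k) (u j)))\<^sup>2))"
    by (simp add: sum_subtractf)
  also have "\<dots> \<le> (\<Sum>k\<in>K. LINT x|M. (norm (e k x - g k x))\<^sup>2)"
    by (intro sum_mono error)
  finally show ?thesis .
qed

section \<open>Trigonometric monomials on the cube\<close>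

text \<open>
  The value 0 off the cube is the convention of \<^const>\<open>C_cube\<close>.
\<close>

definition character :: "nat \<Rightarrow> (nat \<Rightarrow> int) \<Rightarrow> (nat \<Rightarrow> real) \<Rightarrow> complex" where
  "character d k x =
     (if x \<in> cube d then cis (2 * pi * (\<Sum>i<d. of_int (k i) * x i)) else 0)"

definition small_frequencies :: "nat \<Rightarrow> (nat \<Rightarrow> int) set" where
  "small_frequencies d = {..<d} \<rightarrow>\<^sub>E {-2..2}"

lemma finite_small_frequencies: "finite (small_frequencies d)"
  by (simp add: small_frequencies_def finite_PiE)

lemma card_small_frequencies: "card (small_frequencies d) = 5 ^ d"
  by (simp add: small_frequencies_def card_PiE)

lemma small_frequencies_subset: "small_frequencies d \<subseteq> int_vectors d"
  by (auto simp: small_frequencies_def int_vectors_def PiE_def)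

lemma prob_space_unit_interval: "prob_space (restrict_space lborel {0..1::real})"
  by (rule prob_spaceI) (simp add: space_restrict_space emeasure_restrict_space)

lemma prob_space_cube: "prob_space (cube_measure d)"
  unfolding cube_measure_def by (intro prob_space_PiM prob_space_unit_interval)

lemma integral_cis_unit_interval:
  "(LINT t|restrict_space lborel {0..1}. cis (2 * pi * of_int m * t)) = (if m = 0 then 1 else 0)"
proof -
  have "(LINT t|restrict_space lborel {0..1}. cis (2 * pi * of_int m * t))
      = (LINT t:{0..1}|lborel. cis (2 * pi * of_int m * t))"
    by (simp add: integral_restrict_space set_lebesgue_integral_def)
  also have "\<dots> = (if m = 0 then 1 else 0)"
  proof (cases "m = 0")
    case True
    then show ?thesis by (simp add: set_lebesgue_integral_def)
  next
    case False
    define w where "w = 2 * pi * real_of_int m"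
    have w: "w \<noteq> 0" using False by (simp add: w_def)
    have "(LINT t:{0..1}|lborel. cis (w * t)) = - \<i> / w * cis (w * 1) - - \<i> / w * cis (w * 0)"
      unfolding set_lebesgue_integral_def
    proof (rule integral_FTC_atLeastAtMost)
      show "((\<lambda>t. - \<i> / w * cis (w * t)) has_vector_derivative cis (w * t)) (at t within {0..1})"
        for t
      proof -
        have "((\<lambda>z. - \<i> / w * exp (\<i> * (w * z))) has_field_derivative exp (\<i> * (w * of_real t)))
            (at (of_real t))"
          using w by (auto intro!: derivative_eq_intros)
        from has_vector_derivative_real_field[OF this] show ?thesis
          by (simp add: cis_conv_exp)
      qed
      show "continuous_on {0..1} (\<lambda>t. cis (w * t))"
        unfolding cis_conv_exp by (intro continuous_intros)
    qed simp
    also have "cis (w * 1) = 1" by (simp add: w_def)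
    finally show ?thesis using False by (simp add: w_def)
  qed
  finally show ?thesis .
qed

lemma measurable_coordinate:
  assumes "i < d"
  shows "(\<lambda>x. x i) \<in> borel_measurable (cube_measure d)"
proof -
  have "(\<lambda>x. x i) \<in> cube_measure d \<rightarrow>\<^sub>M restrict_space lborel {0..1}"
    using assms unfolding cube_measure_def by (intro measurable_component_singleton) simp
  moreover have "(\<lambda>t. t) \<in> restrict_space lborel {0..1::real} \<rightarrow>\<^sub>M borel"
    by (intro measurable_restrict_space1) simp
  ultimately show ?thesis by (rule measurable_compose)
qed

lemma square_integrable_character: "square_integrable (cube_measure d) (character d k)"
  unfolding square_integrable_def
proof
  interpret prob_space "cube_measure d" by (rule prob_space_cube)
  have "(\<lambda>x. cis (2 * pi * (\<Sum>i<d. of_int (k i) * x i))) \<in> borel_measurable (cube_measure d)"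
    unfolding cis_conv_exp using measurable_coordinate by measurable
  then show "character d k \<in> borel_measurable (cube_measure d)"
    by (rule measurable_cong[THEN iffD1, rotated]) (simp add: space_cube_measure character_def)
  show "integrable (cube_measure d) (\<lambda>x. (norm (character d k x))\<^sup>2)"
    by (rule Bochner_Integration.integrable_cong[THEN iffD1, OF refl _ integrable_const[of 1]])
      (simp add: space_cube_measure character_def)
qed

text \<open>
  The integral over the cube factors into one-dimensional integrals. Two different integer
  vectors differ in some coordinate below \<open>d\<close>, as both are extensional, and the
  corresponding factor vanishes.
\<close>

lemma L2_inner_character:
  assumes "k \<in> int_vectors d" "l \<in> int_vectors d"
  shows "L2_inner (cube_measure d) (character d k) (character d l) = (if k = l then 1 else 0)"
proof -
  interpret I: prob_space "restrict_space lborel {0..1::real}" by (rule prob_space_unit_interval)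
  interpret product_sigma_finite "\<lambda>_::nat. restrict_space lborel {0..1::real}"
    by unfold_locales
  have "character d k x * cnj (character d l x)
      = (\<Prod>i<d. cis (2 * pi * of_int (k i - l i) * x i))" if "x \<in> cube d" for x
  proof -
    have "character d k x * cnj (character d l x)
        = cis (\<Sum>i<d. 2 * pi * of_int (k i - l i) * x i)"
      using that by (simp add: character_def cis_cnj cis_mult algebra_simps sum_subtractf sum_distrib_left)
    also have "\<dots> = (\<Prod>i<d. cis (2 * pi * of_int (k i - l i) * x i))"
      by (simp add: cis_conv_exp sum_distrib_left exp_sum)
    finally show ?thesis .
  qed
  then have "L2_inner (cube_measure d) (character d k) (character d l)
      = (LINT x|cube_measure d. (\<Prod>i<d. cis (2 * pi * of_int (k i - l i) * x i)))"
    unfolding L2_inner_def by (intro Bochner_Integration.integral_cong) (auto simp: space_cube_measure)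
  also have "\<dots> = (\<Prod>i<d. (LINT t|restrict_space lborel {0..1}. cis (2 * pi * of_int (k i - l i) * t)))"
    unfolding cube_measure_def
  proof (rule product_integral_prod)
    show "integrable (restrict_space lborel {0..1::real}) (\<lambda>t. cis (2 * pi * of_int (k i - l i) * t))"
      for i
    proof (rule I.integrable_const_bound[where B = 1])
      show "(\<lambda>t. cis (2 * pi * of_int (k i - l i) * t)) \<in> borel_measurable (restrict_space lborel {0..1::real})"
        unfolding cis_conv_exp by (intro measurable_restrict_space1) measurable
    qed simp
  qed simp
  also have "\<dots> = (\<Prod>i<d. if k i = l i then 1 else 0)"
    by (simp add: integral_cis_unit_interval del: of_int_diff)
  also have "\<dots> = (if \<forall>i<d. k i = l i then 1 else 0)"
    by auto
  also have "(\<forall>i<d. k i = l i) \<longleftrightarrow> k = l"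
    using assms by (auto simp: int_vectors_def intro: PiE_ext)
  finally show ?thesis .
qed

lemma orthonormal_characters: "orthonormal_family (cube_measure d) (small_frequencies d) (character d)"
  using small_frequencies_subset
  by (auto simp: orthonormal_family_def square_integrable_character L2_inner_character subset_iff)

lemma character_in_C_cube: "character d k \<in> C_cube d"
proof -
  have "continuous_on (cube d) (\<lambda>x. cis (2 * pi * (\<Sum>i<d. of_int (k i) * x i)))"
    unfolding cis_conv_exp
    by (intro continuous_intros continuous_on_subset[OF continuous_on_product_coordinates subset_UNIV])
  then have "continuous_on (cube d) (character d k)"
    by (rule continuous_on_cong[THEN iffD1, rotated 2]) (auto simp: character_def)
  then show ?thesis by (simp add: C_cube_def character_def)
qed

lemma fourier_coeff_eq_inner:
  "fourier_coeff d f l = L2_inner (cube_measure d) f (character d l)"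
proof -
  have phase: "exp (- 2 * of_real pi * \<i> * of_real s) = cnj (cis (2 * pi * s))" for s
    unfolding cis_cnj by (simp add: cis_conv_exp algebra_simps)
  show ?thesis
    unfolding fourier_coeff_def L2_inner_def
    by (intro Bochner_Integration.integral_cong refl)
      (simp only: space_cube_measure character_def if_True phase)
qed

text \<open>
  The logarithm of a maximum norm of 1 or 2 is at most 1 by \<open>ln x \<le> x - 1\<close>, and for \<open>k = 0\<close> it
  is \<open>ln 0 = 0\<close>. The dimension must be positive for the maximum to be taken over a nonempty set.
\<close>

lemma log_weight_small_frequency:
  assumes d: "d \<ge> 1" and k: "k \<in> small_frequencies d"
  shows "max 1 (ln (real_of_int (max_norm d k))) = 1"
proof -
  have fin: "finite ((\<lambda>i. \<bar>k i\<bar>) ` {..<d})" and ne: "(\<lambda>i. \<bar>k i\<bar>) ` {..<d} \<noteq> {}"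
    using d by (auto simp: lessThan_empty_iff)
  have "\<bar>k i\<bar> \<le> 2" if "i < d" for i
    using k that by (force simp: small_frequencies_def PiE_iff abs_le_iff)
  then have le: "max_norm d k \<le> 2"
    unfolding max_norm_def using fin ne by auto
  have "max_norm d k \<in> (\<lambda>i. \<bar>k i\<bar>) ` {..<d}"
    unfolding max_norm_def by (rule Max_in[OF fin ne])
  then have "max_norm d k \<ge> 0" by auto
  moreover have "ln (real_of_int (max_norm d k)) \<le> 1" if "max_norm d k > 0"
    using ln_le_minus_one[of "real_of_int (max_norm d k)"] le that by simp
  ultimately show ?thesis by (cases "max_norm d k = 0") auto
qed

lemma character_in_F_log:
  assumes d: "d \<ge> 1" and k: "k \<in> small_frequencies d"
  shows "character d k \<in> F_log d"
proof -
  let ?h = "\<lambda>l. norm (fourier_coeff d (character d k) l) * max 1 (ln (real_of_int (max_norm d l)))"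
  have kI: "k \<in> int_vectors d" using k small_frequencies_subset by blast
  have h: "?h l = (if l = k then 1 else 0)" if "l \<in> int_vectors d" for l
    using L2_inner_character[OF kI that] log_weight_small_frequency[OF d k]
    by (simp add: fourier_coeff_eq_inner)
  have "(?h has_sum 1) (int_vectors d) \<longleftrightarrow> (?h has_sum 1) {k}"
    using h kI by (intro has_sum_cong_neutral) auto
  then have "(?h has_sum 1) (int_vectors d)"
    using has_sum_finite[of "{k}" ?h] h[OF kI] by simp
  then show ?thesis
    unfolding F_log_def using character_in_C_cube by (auto simp: has_sum_imp_summable infsumI)
qed

section \<open>Lower bounds for the worst-case error\<close>

lemma worst_case_error_ge_if_spanned:
  assumes d: "d \<ge> 1" and n: "real n \<le> 5 ^ d / 2"
    and b: "\<And>j. j < n \<Longrightarrow> b j \<in> L2_cube d"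
    and A: "\<And>f. f \<in> F_log d \<Longrightarrow> A f \<in> L2_cube d"
    and span: "\<And>f. f \<in> F_log d \<Longrightarrow> \<exists>c. AE x in cube_measure d. A f x = (\<Sum>j<n. c j * b j x)"
  shows "ereal (1 / sqrt 2) \<le> worst_case_error d (F_log d) A"
proof -
  let ?K = "small_frequencies d"
  let ?err = "\<lambda>k. LINT x|cube_measure d. (norm (character d k x - A (character d k) x))\<^sup>2"
  have "real (card ?K) - real n \<le> (\<Sum>k\<in>?K. ?err k)"
  proof (rule sum_squared_errors_ge[OF finite_small_frequencies orthonormal_characters])
    show "square_integrable (cube_measure d) (b j)" if "j < n" for j
      using b[OF that] by (simp add: L2_cube_def square_integrable_def)
    show "A (character d k) \<in> borel_measurable (cube_measure d)" if "k \<in> ?K" for k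
      using A[OF character_in_F_log[OF d that]] by (simp add: L2_cube_def)
    show "\<exists>c. AE x in cube_measure d. A (character d k) x = (\<Sum>j<n. c j * b j x)"
      if "k \<in> ?K" for k
      by (rule span[OF character_in_F_log[OF d that]])
  qed
  then have "(\<Sum>k\<in>?K. 1 / 2) \<le> (\<Sum>k\<in>?K. ?err k)"
    using n by (simp add: card_small_frequencies)
  then obtain k where k: "k \<in> ?K" and "1 / 2 \<le> ?err k"
    using sum_strict_mono[OF finite_small_frequencies, of d ?err "\<lambda>_. 1 / 2"]
      card_small_frequencies[of d] by (force simp: not_le)
  then have "1 / sqrt 2 \<le> L2_norm d (\<lambda>x. character d k x - A (character d k) x)"
    unfolding L2_norm_def by (metis real_sqrt_divide real_sqrt_le_mono real_sqrt_one)
  also have "ereal \<dots> \<le> worst_case_error d (F_log d) A"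
    unfolding worst_case_error_def by (rule SUP_upper[OF character_in_F_log[OF d k]])
  finally show ?thesis by simp
qed

text \<open>
  Additivity and homogeneity are only available almost everywhere and for two functions at
  a time. So the vector is assembled from its truncations to the first \<open>m\<close> entries, and
  only finitely many exceptional null sets are united.
\<close>

lemma linear_image_spanned_by_unit_vectors:
  assumes lin: "linear_into_L2 d (complex_vectors n) \<phi>" and v: "v \<in> complex_vectors n"
  shows "AE x in cube_measure d. \<phi> v x = (\<Sum>j<n. v j * \<phi> (\<lambda>i. if i = j then 1 else 0) x)"
proof -
  define unit :: "nat \<Rightarrow> nat \<Rightarrow> complex" where "unit j = (\<lambda>i. if i = j then 1 else 0)" for j
  have add: "AE x in cube_measure d. \<phi> (f + g) x = \<phi> f x + \<phi> g x"
    if "f \<in> complex_vectors n" "g \<in> complex_vectors n" for f g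
    using lin that by (simp add: linear_into_L2_def)
  have scale: "AE x in cube_measure d. \<phi> (fun_scale c f) x = c * \<phi> f x"
    if "f \<in> complex_vectors n" for c f
    using lin that by (simp add: linear_into_L2_def)
  have unit: "unit j \<in> complex_vectors n" if "j < n" for j
    using that by (simp add: unit_def complex_vectors_def)
  define trunc where "trunc m = (\<lambda>i. if i < m then v i else 0)" for m
  have trunc: "trunc m \<in> complex_vectors n" for m
    using v by (simp add: trunc_def complex_vectors_def)
  have "m \<le> n \<Longrightarrow> AE x in cube_measure d. \<phi> (trunc m) x = (\<Sum>j<m. v j * \<phi> (unit j) x)" for m
  proof (induction m)
    case 0
    have "fun_scale 0 (trunc 0) = trunc 0" by (simp add: fun_scale_def trunc_def)
    then show ?case using scale[OF trunc[of 0], of 0] by simp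
  next
    case (Suc m)
    have split: "trunc (Suc m) = trunc m + fun_scale (v m) (unit m)"
      by (auto simp: trunc_def fun_scale_def unit_def fun_eq_iff less_Suc_eq)
    have um: "unit m \<in> complex_vectors n" using Suc.prems by (simp add: unit)
    then have "fun_scale (v m) (unit m) \<in> complex_vectors n"
      by (simp add: complex_vectors_def fun_scale_def)
    from add[OF trunc[of m] this] scale[OF um, of "v m"] Suc.IH[OF Suc_leD[OF Suc.prems]]
    show ?case by eventually_elim (simp only: split sum.lessThan_Suc)
  qed
  from this[of n] have "AE x in cube_measure d. \<phi> (trunc n) x = (\<Sum>j<n. v j * \<phi> (unit j) x)" by simp
  moreover have "trunc n = v" using v by (auto simp: trunc_def complex_vectors_def fun_eq_iff)
  ultimately show ?thesis by (simp add: unit_def)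
qed

lemma worst_case_error_sampling_ge:
  assumes d: "d \<ge> 1" and n: "real n \<le> 5 ^ d / 2" and A: "sampling_algorithm d n A"
  shows "ereal (1 / sqrt 2) \<le> worst_case_error d (F_log d) A"
proof -
  obtain p \<phi> where lin: "linear_into_L2 d (complex_vectors n) \<phi>"
    and A_eq: "A = (\<lambda>f. \<phi> (\<lambda>j. if j < n then f (p j) else 0))"
    using A unfolding sampling_algorithm_def by blast
  have samples: "(\<lambda>j. if j < n then f (p j) else 0) \<in> complex_vectors n"
    for f :: "(nat \<Rightarrow> real) \<Rightarrow> complex"
    by (simp add: complex_vectors_def)
  have L2: "\<phi> v \<in> L2_cube d" if "v \<in> complex_vectors n" for v
    using lin that by (simp add: linear_into_L2_def)
  show ?thesis
  proof (rule worst_case_error_ge_if_spanned[OF d n])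
    show "\<phi> (\<lambda>i. if i = j then 1 else 0) \<in> L2_cube d" if "j < n" for j
      using that by (intro L2) (simp add: complex_vectors_def)
    show "A f \<in> L2_cube d" for f
      unfolding A_eq by (rule L2[OF samples])
    show "\<exists>c. AE x in cube_measure d. A f x = (\<Sum>j<n. c j * \<phi> (\<lambda>i. if i = j then 1 else 0) x)" for f
      unfolding A_eq using linear_image_spanned_by_unit_vectors[OF lin samples, of f]
      by (rule exI[where x = "\<lambda>j. if j < n then f (p j) else 0"])
  qed
qed

lemma curse_of_dimensionality_F_log: "curse_of_dimensionality F_log"
proof -
  have "ereal (1 / 2 * (1 + 4) ^ d) \<le> sample_complexity d (F_log d) (1 / 2)" if d: "d \<ge> 1" for d
    unfolding sample_complexity_def
  proof (rule INF_greatest, clarify)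
    fix n A
    assume A: "sampling_algorithm d n A" and err: "worst_case_error d (F_log d) A \<le> ereal (1 / 2)"
    (* any accuracy below 1 / sqrt 2 would serve; C = 1/2 and 1 + 4 = 5 reproduce the bound 5^d / 2 *)
    have "\<not> ereal (1 / sqrt 2) \<le> ereal (1 / 2)"
      using sqrt2_less_2 by (simp add: field_simps)
    then have "\<not> real n \<le> 5 ^ d / 2"
      using order_trans[OF worst_case_error_sampling_ge[OF d _ A] err] by blast
    then show "ereal (1 / 2 * (1 + 4) ^ d) \<le> ereal (real n)" by simp
  qed
  then show ?thesis
    unfolding curse_of_dimensionality_def
    by (intro exI[of _ "1/2"] conjI exI[of _ 4] exI[of _ "1/2"]) (auto simp: mult.commute)
qed

theorem lemma18:
  "curse_of_dimensionality F_log \<and>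
   (\<forall>d\<ge>1. \<forall>A n.
      linear_into_L2 d (complex_span (F_log d)) A \<longrightarrow>
      has_rank d (complex_span (F_log d)) A n \<longrightarrow>
      real n \<le> 5 ^ d / 2 \<longrightarrow>
      worst_case_error d (F_log d) A \<ge> ereal (1 / sqrt 2))"
proof (intro conjI curse_of_dimensionality_F_log allI impI)
  fix d n :: nat and A :: "((nat \<Rightarrow> real) \<Rightarrow> complex) \<Rightarrow> (nat \<Rightarrow> real) \<Rightarrow> complex"
  assume d: "d \<ge> 1" and lin: "linear_into_L2 d (complex_span (F_log d)) A"
    and rank: "has_rank d (complex_span (F_log d)) A n" and n: "real n \<le> 5 ^ d / 2"
  interpret V: vector_space "fun_scale :: complex \<Rightarrow> ((nat \<Rightarrow> real) \<Rightarrow> complex) \<Rightarrow> _"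
    by (rule vector_space_fun_scale)
  have base: "f \<in> complex_span (F_log d)" if "f \<in> F_log d" for f
    unfolding complex_span_def using that by (rule V.span_base)
  have L2: "A f \<in> L2_cube d" if "f \<in> complex_span (F_log d)" for f
    using lin that by (simp add: linear_into_L2_def)
  obtain b where b: "\<forall>j<n. b j \<in> A ` complex_span (F_log d)"
    and span: "\<forall>g\<in>A ` complex_span (F_log d). \<exists>c. AE x in cube_measure d. g x = (\<Sum>j<n. c j * b j x)"
    using rank unfolding has_rank_def has_L2_dim_def by blast
  show "worst_case_error d (F_log d) A \<ge> ereal (1 / sqrt 2)"
  proof (rule worst_case_error_ge_if_spanned[OF d n])
    show "b j \<in> L2_cube d" if "j < n" for j
      using b that L2 by auto
    show "A f \<in> L2_cube d" if "f \<in> F_log d" for f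
      by (rule L2[OF base[OF that]])
    show "\<exists>c. AE x in cube_measure d. A f x = (\<Sum>j<n. c j * b j x)" if "f \<in> F_log d" for f
      using span base[OF that] by (rule bspec[OF _ imageI])
  qed
qed

end
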